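(* Let $(X,\mathcal{E})$ be a connected coarse space. For $A,B\subseteq X$ define $A\prec B$ if for every $E\in\mathcal{E}$ there is a bounded set $K\subseteq X$ with $E[A]\subseteq B\cup K$, and define $A\prec^* B$ if $A\subseteq B$ and $A\prec B$. Then the following are equivalent: (i) $(X,\mathcal{E})$ is coarsely normal; (ii) for all $A,B\subseteq X$, $A\prec^* B$ implies that there exists a subset $C\subseteq X$ satisfying $A\prec^* C\prec^* B$.
   Context: A coarse structure on a set $X$ is a collection $\mathcal{E}$ of subsets of $X\times X$ (called controlled sets or entourages) that contains the diagonal $\triangle=\{(x,x)\mid x\in X\}$ and is closed under taking subsets, inverses $E^{-1}=\{(x,y)\mid (y,x)\in E\}$, finite unions, and compositions $E\circ F=\{(x,y)\mid \exists z\in X,\ (x,z)\in E,\ (z,y)\in F\}$. The pair $(X,\mathcal{E})$ is a coarse space. It is connected if each point of $X\times X$ belongs to some controlled set. For $A\subseteq X$ and $E\in\mathcal{E}$, $E[A]=\{x\in X\mid \exists a\in A,\ (x,a)\in E\}$. A subset $A\subseteq X$ is bounded if $A\times A\in\mathcal{E}$. $(X,\mathcal{E})$ is coarsely normal if for all $A,B\subseteq X$ with $A\prec B$ there is $C\subseteq X$ with $A\prec C\prec B$. *)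

theory Defs
  imports Main
begin

text \<open>A coarse space is a carrier set \<open>X\<close> with a family \<open>\<E>\<close> of subsets of \<open>X \<times> X\<close>.
  Closure under the empty union is not listed: it follows from closure under subsets.\<close>

definition coarse_space :: "'a set \<Rightarrow> ('a \<times> 'a) set set \<Rightarrow> bool" where
  "coarse_space X \<E> \<longleftrightarrow>
     (\<forall>E\<in>\<E>. E \<subseteq> X \<times> X) \<and>
     Id_on X \<in> \<E> \<and>
     (\<forall>E\<in>\<E>. \<forall>F. F \<subseteq> E \<longrightarrow> F \<in> \<E>) \<and>
     (\<forall>E\<in>\<E>. E\<inverse> \<in> \<E>) \<and>
     (\<forall>E\<in>\<E>. \<forall>F\<in>\<E>. E \<union> F \<in> \<E>) \<and>
     (\<forall>E\<in>\<E>. \<forall>F\<in>\<E>. E O F \<in> \<E>)"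

definition connected_coarse_space :: "'a set \<Rightarrow> ('a \<times> 'a) set set \<Rightarrow> bool" where
  "connected_coarse_space X \<E> \<longleftrightarrow>
     coarse_space X \<E> \<and> (\<forall>p \<in> X \<times> X. \<exists>E\<in>\<E>. p \<in> E)"

text \<open>\<open>E[A]\<close> collects first coordinates, so it is the image \<open>E\<inverse> `` A\<close> rather than \<open>E `` A\<close>.\<close>

definition coarse_nbhd :: "'a set \<Rightarrow> ('a \<times> 'a) set \<Rightarrow> 'a set \<Rightarrow> 'a set" where
  "coarse_nbhd X E A = {x \<in> X. \<exists>a\<in>A. (x, a) \<in> E}"

definition coarsely_bounded :: "'a set \<Rightarrow> ('a \<times> 'a) set set \<Rightarrow> 'a set \<Rightarrow> bool" where
  "coarsely_bounded X \<E> A \<longleftrightarrow> A \<subseteq> X \<and> A \<times> A \<in> \<E>"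

definition coarse_prec :: "'a set \<Rightarrow> ('a \<times> 'a) set set \<Rightarrow> 'a set \<Rightarrow> 'a set \<Rightarrow> bool" where
  "coarse_prec X \<E> A B \<longleftrightarrow>
     (\<forall>E\<in>\<E>. \<exists>K. coarsely_bounded X \<E> K \<and> coarse_nbhd X E A \<subseteq> B \<union> K)"

definition coarse_prec_star :: "'a set \<Rightarrow> ('a \<times> 'a) set set \<Rightarrow> 'a set \<Rightarrow> 'a set \<Rightarrow> bool" where
  "coarse_prec_star X \<E> A B \<longleftrightarrow> A \<subseteq> B \<and> coarse_prec X \<E> A B"

definition coarsely_normal :: "'a set \<Rightarrow> ('a \<times> 'a) set set \<Rightarrow> bool" where
  "coarsely_normal X \<E> \<longleftrightarrow>
     (\<forall>A B. A \<subseteq> X \<longrightarrow> B \<subseteq> X \<longrightarrow> coarse_prec X \<E> A B \<longrightarrow>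
        (\<exists>C. C \<subseteq> X \<and> coarse_prec X \<E> A C \<and> coarse_prec X \<E> C B))"

end

theory Submission
  imports Defs
begin

text \<open>Both directions adjust the given sets by the lattice operations, which respect \<open>\<prec>\<close>: it passes to
  unions on the left and to intersections on the right, because a union of two bounded sets is
  bounded in a connected coarse space.

  If \<open>A \<prec>\<^sup>* B\<close> and \<open>A \<prec> C \<prec> B\<close>, then \<open>(A \<union> C) \<inter> B\<close> lies between \<open>A\<close> and \<open>B\<close> both for inclusion and
  for \<open>\<prec>\<close>. Conversely, if \<open>A \<prec> B\<close>, then the diagonal entourage shows that \<open>A\<close> is contained in
  \<open>B\<close> up to a bounded set \<open>K\<close>. Hence \<open>A \<inter> B \<prec>\<^sup>* B\<close>, and any \<open>C\<close> interpolating here also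
  interpolates between \<open>A\<close> and \<open>B\<close>: the part of \<open>A\<close> inside \<open>K\<close> does not matter, since a bounded
  set \<open>K\<close> satisfies \<open>K \<prec> C\<close> for every \<open>C\<close>.\<close>

lemma coarse_space_controlled:
  assumes "coarse_space X \<E>"
  shows coarse_space_Id_on: "Id_on X \<in> \<E>"
    and coarse_space_subset: "E \<in> \<E> \<Longrightarrow> F \<subseteq> E \<Longrightarrow> F \<in> \<E>"
    and coarse_space_converse: "E \<in> \<E> \<Longrightarrow> E\<inverse> \<in> \<E>"
    and coarse_space_Un: "E \<in> \<E> \<Longrightarrow> F \<in> \<E> \<Longrightarrow> E \<union> F \<in> \<E>"
    and coarse_space_relcomp: "E \<in> \<E> \<Longrightarrow> F \<in> \<E> \<Longrightarrow> E O F \<in> \<E>"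
  using assms unfolding coarse_space_def by blast+

lemma coarsely_bounded_Un:
  assumes conn: "connected_coarse_space X \<E>"
    and K: "coarsely_bounded X \<E> K" and L: "coarsely_bounded X \<E> L"
  shows "coarsely_bounded X \<E> (K \<union> L)"
proof (cases "K = {} \<or> L = {}")
  case True
  then show ?thesis using K L by auto
next
  case False
  then obtain k l where kl: "k \<in> K" "l \<in> L" by auto
  have cs: "coarse_space X \<E>" using conn by (simp add: connected_coarse_space_def)
  have sub: "K \<subseteq> X" "L \<subseteq> X" and sq: "K \<times> K \<in> \<E>" "L \<times> L \<in> \<E>"
    using K L by (auto simp: coarsely_bounded_def)
  have "(k, l) \<in> X \<times> X" using kl sub by auto
  then obtain E where E: "E \<in> \<E>" "(k, l) \<in> E"
    using conn unfolding connected_coarse_space_def by blast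
  \<comment> \<open>The single pair \<open>(k, l)\<close> joins the two sets: \<open>K \<times> L\<close> is controlled through it.\<close>
  define F where "F = (K \<times> K) O E O (L \<times> L)"
  have F: "F \<in> \<E>" unfolding F_def by (intro coarse_space_relcomp[OF cs] sq E)
  have "K \<times> L \<subseteq> F" using kl E unfolding F_def by blast
  then have "(K \<union> L) \<times> (K \<union> L) \<subseteq> (K \<times> K) \<union> (L \<times> L) \<union> (F \<union> F\<inverse>)" by blast
  moreover have "(K \<times> K) \<union> (L \<times> L) \<union> (F \<union> F\<inverse>) \<in> \<E>"
    by (intro coarse_space_Un[OF cs] coarse_space_converse[OF cs] sq F)
  ultimately have "(K \<union> L) \<times> (K \<union> L) \<in> \<E>"
    by (rule coarse_space_subset[OF cs, rotated])
  then show ?thesis using sub by (simp add: coarsely_bounded_def)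
qed

lemma coarsely_bounded_coarse_nbhd:
  assumes cs: "coarse_space X \<E>" and K: "coarsely_bounded X \<E> K" and E: "E \<in> \<E>"
  shows "coarsely_bounded X \<E> (coarse_nbhd X E K)"
proof -
  have "coarse_nbhd X E K \<times> coarse_nbhd X E K \<subseteq> E O (K \<times> K) O E\<inverse>"
    unfolding coarse_nbhd_def by blast
  moreover have "E O (K \<times> K) O E\<inverse> \<in> \<E>"
    using K E unfolding coarsely_bounded_def
    by (intro coarse_space_relcomp[OF cs] coarse_space_converse[OF cs]) auto
  ultimately have "coarse_nbhd X E K \<times> coarse_nbhd X E K \<in> \<E>"
    by (rule coarse_space_subset[OF cs, rotated])
  then show ?thesis unfolding coarsely_bounded_def coarse_nbhd_def by blast
qed

lemma coarse_prec_bounded: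
  assumes "coarse_space X \<E>" "coarsely_bounded X \<E> K"
  shows "coarse_prec X \<E> K B"
  using coarsely_bounded_coarse_nbhd[OF assms] unfolding coarse_prec_def by blast

lemma coarse_prec_mono:
  assumes "coarse_prec X \<E> A B" "A' \<subseteq> A" "B \<subseteq> B'"
  shows "coarse_prec X \<E> A' B'"
  unfolding coarse_prec_def
proof
  fix E assume "E \<in> \<E>"
  then obtain K where "coarsely_bounded X \<E> K" "coarse_nbhd X E A \<subseteq> B \<union> K"
    using assms(1) unfolding coarse_prec_def by blast
  moreover have "coarse_nbhd X E A' \<subseteq> coarse_nbhd X E A"
    using assms(2) unfolding coarse_nbhd_def by blast
  ultimately show "\<exists>K. coarsely_bounded X \<E> K \<and> coarse_nbhd X E A' \<subseteq> B' \<union> K"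
    using assms(3) by blast
qed

lemma coarse_prec_Un_left:
  assumes conn: "connected_coarse_space X \<E>"
    and A: "coarse_prec X \<E> A B" and A': "coarse_prec X \<E> A' B"
  shows "coarse_prec X \<E> (A \<union> A') B"
  unfolding coarse_prec_def
proof
  fix E assume E: "E \<in> \<E>"
  obtain K where K: "coarsely_bounded X \<E> K" "coarse_nbhd X E A \<subseteq> B \<union> K"
    using A E unfolding coarse_prec_def by blast
  obtain L where L: "coarsely_bounded X \<E> L" "coarse_nbhd X E A' \<subseteq> B \<union> L"
    using A' E unfolding coarse_prec_def by blast
  have "coarse_nbhd X E (A \<union> A') = coarse_nbhd X E A \<union> coarse_nbhd X E A'"
    unfolding coarse_nbhd_def by blast
  then have "coarse_nbhd X E (A \<union> A') \<subseteq> B \<union> (K \<union> L)" using K L by blast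
  then show "\<exists>K. coarsely_bounded X \<E> K \<and> coarse_nbhd X E (A \<union> A') \<subseteq> B \<union> K"
    using coarsely_bounded_Un[OF conn K(1) L(1)] by blast
qed

lemma coarse_prec_Int_right:
  assumes conn: "connected_coarse_space X \<E>"
    and B: "coarse_prec X \<E> A B" and B': "coarse_prec X \<E> A B'"
  shows "coarse_prec X \<E> A (B \<inter> B')"
  unfolding coarse_prec_def
proof
  fix E assume E: "E \<in> \<E>"
  obtain K where K: "coarsely_bounded X \<E> K" "coarse_nbhd X E A \<subseteq> B \<union> K"
    using B E unfolding coarse_prec_def by blast
  obtain L where L: "coarsely_bounded X \<E> L" "coarse_nbhd X E A \<subseteq> B' \<union> L"
    using B' E unfolding coarse_prec_def by blast
  have "coarse_nbhd X E A \<subseteq> (B \<inter> B') \<union> (K \<union> L)" using K L by blast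
  then show "\<exists>K. coarsely_bounded X \<E> K \<and> coarse_nbhd X E A \<subseteq> (B \<inter> B') \<union> K"
    using coarsely_bounded_Un[OF conn K(1) L(1)] by blast
qed

lemma coarse_prec_imp_subset_Un_bounded:
  assumes cs: "coarse_space X \<E>" and "A \<subseteq> X" and AB: "coarse_prec X \<E> A B"
  obtains K where "coarsely_bounded X \<E> K" "A \<subseteq> B \<union> K"
proof -
  have "Id_on X \<in> \<E>" by (rule coarse_space_Id_on[OF cs])
  then obtain K where "coarsely_bounded X \<E> K" "coarse_nbhd X (Id_on X) A \<subseteq> B \<union> K"
    using AB unfolding coarse_prec_def by blast
  moreover have "coarse_nbhd X (Id_on X) A = A"
    using \<open>A \<subseteq> X\<close> unfolding coarse_nbhd_def by blast
  ultimately show ?thesis using that by simp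
qed

theorem proposition3p21:
  fixes X :: "'a set" and \<E> :: "('a \<times> 'a) set set"
  assumes "connected_coarse_space X \<E>"
  shows "coarsely_normal X \<E> \<longleftrightarrow>
    (\<forall>A B. A \<subseteq> X \<longrightarrow> B \<subseteq> X \<longrightarrow> coarse_prec_star X \<E> A B \<longrightarrow>
       (\<exists>C. C \<subseteq> X \<and> coarse_prec_star X \<E> A C \<and> coarse_prec_star X \<E> C B))"
    (is "_ \<longleftrightarrow> ?star")
proof
  assume normal: "coarsely_normal X \<E>"
  show ?star
  proof (intro allI impI)
    fix A B assume sub: "A \<subseteq> X" "B \<subseteq> X" and "coarse_prec_star X \<E> A B"
    then have AB: "A \<subseteq> B" "coarse_prec X \<E> A B" by (auto simp: coarse_prec_star_def)
    obtain C where C: "coarse_prec X \<E> A C" "coarse_prec X \<E> C B"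
      using normal[unfolded coarsely_normal_def, rule_format, OF sub AB(2)] by blast
    let ?C = "(A \<union> C) \<inter> B"
    have "coarse_prec X \<E> A (A \<union> C)" using C(1) by (rule coarse_prec_mono) auto
    then have "coarse_prec X \<E> A ?C" using AB(2) by (rule coarse_prec_Int_right[OF assms])
    moreover have "coarse_prec X \<E> ?C B"
      using coarse_prec_Un_left[OF assms AB(2) C(2)] by (rule coarse_prec_mono) auto
    ultimately show "\<exists>C. C \<subseteq> X \<and> coarse_prec_star X \<E> A C \<and> coarse_prec_star X \<E> C B"
      using AB(1) sub by (intro exI[of _ ?C]) (auto simp: coarse_prec_star_def)
  qed
next
  assume star: ?star
  have cs: "coarse_space X \<E>" using assms by (simp add: connected_coarse_space_def)
  show "coarsely_normal X \<E>"
    unfolding coarsely_normal_def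
  proof (intro allI impI)
    fix A B assume sub: "A \<subseteq> X" "B \<subseteq> X" and AB: "coarse_prec X \<E> A B"
    obtain K where K: "coarsely_bounded X \<E> K" "A \<subseteq> B \<union> K"
      using coarse_prec_imp_subset_Un_bounded[OF cs sub(1) AB] .
    have "coarse_prec X \<E> (A \<inter> B) B" using AB by (rule coarse_prec_mono) auto
    then have "coarse_prec_star X \<E> (A \<inter> B) B" by (simp add: coarse_prec_star_def)
    moreover have "A \<inter> B \<subseteq> X" using sub by blast
    ultimately obtain C where C: "C \<subseteq> X" "coarse_prec_star X \<E> (A \<inter> B) C"
        "coarse_prec_star X \<E> C B"
      using star[rule_format, of "A \<inter> B" B] sub(2) by metis
    have "coarse_prec X \<E> (A \<inter> B \<union> K) C"
      using C(2) coarse_prec_bounded[OF cs K(1)]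
      by (intro coarse_prec_Un_left[OF assms]) (auto simp: coarse_prec_star_def)
    then have "coarse_prec X \<E> A C" by (rule coarse_prec_mono) (use K(2) in auto)
    then show "\<exists>C. C \<subseteq> X \<and> coarse_prec X \<E> A C \<and> coarse_prec X \<E> C B"
      using C by (auto simp: coarse_prec_star_def)
  qed
qed

end
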